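(* For every prime $p \ge 5$, there exists a set $A \subseteq \mathbb{F}_p$ such that $|A| = \frac{p-1}{2}$, $1 \notin A+A$, and $1 \notin AA$.
   Context: $\mathbb{F}_p$ denotes the field with $p$ elements. For $A \subseteq \mathbb{F}_p$, $A+A = \{a+a' : a,a' \in A\}$ and $AA = \{aa' : a,a' \in A\}$ (with $a=a'$ allowed). *)

theory Defs
  imports "HOL-Number_Theory.Number_Theory"
begin

end

theory Submission
  imports Defs
begin

text \<open>
  The rational function \<open>h(x) = (x + 1)(x - 2)(2x - 1) / (x(x - 1))\<close> changes sign under both
  \<open>x \<mapsto> 1 - x\<close> and \<open>x \<mapsto> 1/x\<close>. Hence the set of all \<open>x\<close> for which \<open>h(x)\<close> has a residue in
  \<open>{1, \<dots>, (p - 1)/2}\<close> contains no two elements with sum or product 1, and together with its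
  reflection under \<open>x \<mapsto> 1 - x\<close> it exhausts the residues other than the poles 0, 1 and the zeros
  -1, 2, 1/2 of \<open>h\<close>. Adding 0 and 2 to this set yields \<open>A\<close>.
\<close>

text \<open>The denominator of \<open>h\<close> is cleared, so no inverse modulo \<open>p\<close>
  occurs; the congruence determines \<open>h(x)\<close> only away from the poles 0 and 1.\<close>

definition lower_half :: "int \<Rightarrow> int \<Rightarrow> bool" where
  "lower_half p x \<longleftrightarrow>
    (\<exists>k. 0 < k \<and> 2 * k < p \<and> [k * (x * (x - 1)) = (x + 1) * (x - 2) * (2 * x - 1)] (mod p))"

text \<open>As \<open>k\<close> is nonzero modulo \<open>p\<close>, so is the numerator. This
  excludes -1 and 1/2, the partners of 2 for sum and product 1.\<close>

lemma lower_half_not_zero: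
  assumes "prime p" "lower_half p x" "\<not> p dvd x" "\<not> p dvd x - 1"
  shows "\<not> p dvd x + 1" "\<not> p dvd x - 2" "\<not> p dvd 2 * x - 1"
proof -
  obtain k where k: "0 < k" "2 * k < p"
    and eq: "[k * (x * (x - 1)) = (x + 1) * (x - 2) * (2 * x - 1)] (mod p)"
    using assms(2) unfolding lower_half_def by blast
  have "\<not> p dvd k"
    using k by (auto dest: zdvd_imp_le)
  then have "\<not> p dvd k * (x * (x - 1))"
    using assms by (simp add: prime_dvd_mult_iff)
  then have "\<not> p dvd (x + 1) * (x - 2) * (2 * x - 1)"
    using cong_dvd_iff[OF eq] by simp
  then show "\<not> p dvd x + 1" "\<not> p dvd x - 2" "\<not> p dvd 2 * x - 1"
    by auto
qed

text \<open>Common core of the sum and product cases. By \<open>neg\<close>,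
  \<open>h(y) = -h(x)\<close>, so the two values satisfy \<open>p dvd l + k\<close>, which
  contradicts \<open>0 < l + k < p\<close>.\<close>

lemma not_both_lower_half:
  assumes "prime p" "lower_half p x" "lower_half p y" "\<not> p dvd y" "\<not> p dvd y - 1"
    and neg: "\<And>k. [k * (x * (x - 1)) = (x + 1) * (x - 2) * (2 * x - 1)] (mod p) \<Longrightarrow>
      [- k * (y * (y - 1)) = (y + 1) * (y - 2) * (2 * y - 1)] (mod p)"
  shows False
proof -
  obtain k where k: "0 < k" "2 * k < p"
    and "[k * (x * (x - 1)) = (x + 1) * (x - 2) * (2 * x - 1)] (mod p)"
    using assms(2) unfolding lower_half_def by blast
  then have 1: "[- k * (y * (y - 1)) = (y + 1) * (y - 2) * (2 * y - 1)] (mod p)"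
    using neg by blast
  obtain l where l: "0 < l" "2 * l < p"
    and 2: "[l * (y * (y - 1)) = (y + 1) * (y - 2) * (2 * y - 1)] (mod p)"
    using assms(3) unfolding lower_half_def by blast
  have "[l * (y * (y - 1)) = - k * (y * (y - 1))] (mod p)"
    using 1 2 by (metis cong_sym cong_trans)
  then have "p dvd (l + k) * (y * (y - 1))"
    by (simp add: cong_iff_dvd_diff algebra_simps)
  then have "p dvd l + k"
    using assms by (simp add: prime_dvd_mult_iff)
  then show False
    using k l by (auto dest: zdvd_imp_le)
qed

text \<open>Under \<open>1 - x\<close> the factors \<open>x + 1\<close> and \<open>x - 2\<close>
  swap up to sign and \<open>2 * x - 1\<close> is negated: the numerator changes sign, the
  denominator does not.\<close>

lemma lower_half_sum:
  assumes "prime p" "lower_half p x" "lower_half p y" "\<not> p dvd y" "\<not> p dvd y - 1"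
    and xy: "[x + y = 1] (mod p)"
  shows False
proof (rule not_both_lower_half[OF assms(1-5)])
  fix k
  assume eq: "[k * (x * (x - 1)) = (x + 1) * (x - 2) * (2 * x - 1)] (mod p)"
  have y: "[y = 1 - x] (mod p)"
    using xy by (simp add: cong_iff_dvd_diff algebra_simps)
  have "[- k * (y * (y - 1)) = - k * ((1 - x) * ((1 - x) - 1))] (mod p)"
    by (intro cong_mult cong_diff cong_refl y)
  also have "- k * ((1 - x) * ((1 - x) - 1)) = - (k * (x * (x - 1)))"
    by (simp add: algebra_simps)
  also have "[\<dots> = - ((x + 1) * (x - 2) * (2 * x - 1))] (mod p)"
    using eq by (simp add: cong_minus_minus_iff)
  also have "- ((x + 1) * (x - 2) * (2 * x - 1)) =
      ((1 - x) + 1) * ((1 - x) - 2) * (2 * (1 - x) - 1)"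
    by (simp add: algebra_simps)
  also have "[\<dots> = (y + 1) * (y - 2) * (2 * y - 1)] (mod p)"
    by (intro cong_mult cong_diff cong_add cong_refl cong_sym[OF y])
  finally show "[- k * (y * (y - 1)) = (y + 1) * (y - 2) * (2 * y - 1)] (mod p)" .
qed

text \<open>Under inversion the numerator is multiplied by \<open>y ^ 3\<close> and the denominator
  by \<open>- (y ^ 3)\<close>, so the sign comes from the denominator.\<close>

lemma lower_half_prod:
  assumes "prime p" "lower_half p x" "lower_half p y" "\<not> p dvd y" "\<not> p dvd y - 1"
    and xy: "[x * y = 1] (mod p)"
  shows False
proof (rule not_both_lower_half[OF assms(1-5)])
  fix k
  assume eq: "[k * (x * (x - 1)) = (x + 1) * (x - 2) * (2 * x - 1)] (mod p)"
  \<comment> \<open>The explicit 1 is kept so that \<open>x * y\<close> can replace it; then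
    \<open>y ^ 3\<close> factors out and \<open>eq\<close> applies.\<close>
  have "- k * (y * (y - 1)) = k * (1 * (1 - y) * y)"
    by (simp add: algebra_simps)
  also have "[\<dots> = k * ((x * y) * (x * y - y) * y)] (mod p)"
    by (intro cong_mult cong_diff cong_refl cong_sym[OF xy])
  also have "k * ((x * y) * (x * y - y) * y) = k * (x * (x - 1)) * y ^ 3"
    by (simp add: algebra_simps power3_eq_cube)
  also have "[\<dots> = (x + 1) * (x - 2) * (2 * x - 1) * y ^ 3] (mod p)"
    by (intro cong_mult eq cong_refl)
  also have "(x + 1) * (x - 2) * (2 * x - 1) * y ^ 3 =
      (x * y + y) * (x * y - 2 * y) * (2 * (x * y) - y)"
    by (simp add: algebra_simps power3_eq_cube)
  also have "[\<dots> = (1 + y) * (1 - 2 * y) * (2 * 1 - y)] (mod p)"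
    by (intro cong_mult cong_diff cong_add cong_refl xy)
  also have "(1 + y) * (1 - 2 * y) * (2 * 1 - y) = (y + 1) * (y - 2) * (2 * y - 1)"
    by (simp add: algebra_simps)
  finally show "[- k * (y * (y - 1)) = (y + 1) * (y - 2) * (2 * y - 1)] (mod p)" .
qed

text \<open>Here \<open>h(x)\<close> is a nonzero residue \<open>k\<close>, and \<open>h(y)\<close>
  is \<open>p - k\<close>; one of the two lies below \<open>p / 2\<close>.\<close>

lemma lower_half_or_reflection:
  assumes "prime p" "\<not> p dvd x" "\<not> p dvd x - 1"
    and "\<not> p dvd x + 1" "\<not> p dvd x - 2" "\<not> p dvd 2 * x - 1"
    and "odd p" and y: "[y = 1 - x] (mod p)"
  shows "lower_half p x \<or> lower_half p y"
proof -
  have p: "p > 1"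
    using \<open>prime p\<close> by (rule prime_gt_1_int)
  let ?d = "x * (x - 1)" and ?n = "(x + 1) * (x - 2) * (2 * x - 1)"
  have n: "\<not> p dvd ?n"
    using assms by (simp add: prime_dvd_mult_iff)
  have "coprime ?d p"
    using assms by (metis coprime_commute prime_dvd_mult_iff prime_imp_coprime)
  then obtain z where z: "[?d * z = 1] (mod p)"
    using cong_solve_coprime_int by blast
  \<comment> \<open>The reduced representative of \<open>h(x)\<close>, with \<open>z\<close> the
    inverse of the denominator.\<close>
  define k where "k = (z * ?n) mod p"
  have "[k * ?d = z * ?n * ?d] (mod p)"
    unfolding k_def by (intro cong_mult cong_refl) simp
  also have "z * ?n * ?d = (?d * z) * ?n"
    by (simp only: ac_simps)
  also have "[\<dots> = 1 * ?n] (mod p)"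
    by (intro cong_mult z cong_refl)
  finally have k: "[k * ?d = ?n] (mod p)"
    by simp
  have "k \<noteq> 0"
    using k n by (auto simp: cong_0_iff cong_sym_eq[of 0])
  then have k_bounds: "0 < k" "k < p"
    using p pos_mod_bound[of p "z * ?n"] pos_mod_sign[of p "z * ?n"]
    unfolding k_def by linarith+
  show ?thesis
  proof (cases "2 * k < p")
    case True
    then show ?thesis
      using k k_bounds unfolding lower_half_def by blast
  next
    case False
    then have "2 * (p - k) < p"
      using \<open>odd p\<close> by (cases "2 * k = p") auto
    moreover have "[(p - k) * (y * (y - 1)) = (y + 1) * (y - 2) * (2 * y - 1)] (mod p)"
    proof -
      have "[(p - k) * (y * (y - 1)) = (0 - k) * ((1 - x) * ((1 - x) - 1))] (mod p)"
        by (intro cong_mult cong_diff cong_refl y) (simp add: cong_0_iff)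
      also have "(0 - k) * ((1 - x) * ((1 - x) - 1)) = - (k * ?d)"
        by (simp add: algebra_simps)
      also have "[\<dots> = - ?n] (mod p)"
        using k by (simp add: cong_minus_minus_iff)
      also have "- ?n = ((1 - x) + 1) * ((1 - x) - 2) * (2 * (1 - x) - 1)"
        by (simp add: algebra_simps)
      also have "[\<dots> = (y + 1) * (y - 2) * (2 * y - 1)] (mod p)"
        by (intro cong_mult cong_diff cong_add cong_refl cong_sym[OF y])
      finally show ?thesis .
    qed
    ultimately show ?thesis
      using k_bounds unfolding lower_half_def by (metis diff_gt_0_iff_gt)
  qed
qed

theorem theorem2p2:
  fixes p :: nat
  assumes "prime p" and "p \<ge> 5"
  shows "\<exists>A. A \<subseteq> carrier (residue_ring (int p)) \<and>
    card A = (p - 1) div 2 \<and>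
    \<one>\<^bsub>residue_ring (int p)\<^esub> \<notin> A <+>\<^bsub>residue_ring (int p)\<^esub> A \<and>
    \<one>\<^bsub>residue_ring (int p)\<^esub> \<notin> A <#>\<^bsub>residue_ring (int p)\<^esub> A"
proof -
  define q where "q = int p"
  have q: "prime q" "q \<ge> 5"
    using assms by (auto simp: q_def)
  have odd: "odd q"
    using q prime_odd_int[of q] by simp
  \<comment> \<open>The range leaves out 0 and 1; 0 is inserted at the end. The zero 2 of
    \<open>h\<close> is added by hand.\<close>
  define B where "B = {x \<in> {2..q - 1}. x = 2 \<or> lower_half q x}"
  have ndvd: "\<not> q dvd x" "\<not> q dvd x - 1" if "x \<in> {2..q - 1}" for x
    using that zdvd_imp_le[of q x] zdvd_imp_le[of q "x - 1"] by auto
  \<comment> \<open>The number 3 is both \<open>2 + 2 - 1\<close> and \<open>2 * 2 - 1\<close>, so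
    this handles 2 paired with itself.\<close>
  have two: "\<not> q dvd 3" "\<not> q dvd 2 - 1"
    using q zdvd_imp_le[of q 3] by auto
  have not_zero: "\<not> q dvd y + 1" "y \<noteq> 2 \<Longrightarrow> \<not> q dvd y - 2" "\<not> q dvd 2 * y - 1" if "y \<in> B" for y
    using that lower_half_not_zero[OF q(1), of y] ndvd[of y] two
    unfolding B_def by auto
  have sum: False if xy: "x \<in> B" "y \<in> B" "[x + y = 1] (mod q)" for x y
  proof -
    have d: "q dvd x + y - 1"
      using xy(3) by (simp add: cong_iff_dvd_diff)
    consider "x = 2" | "y = 2" | "lower_half q x" "lower_half q y"
      using xy(1,2) unfolding B_def by blast
    then show False
    proof cases
      case 1
      then show False using d not_zero(1)[OF xy(2)] by (simp add: algebra_simps)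
    next
      case 2
      then show False using d not_zero(1)[OF xy(1)] by (simp add: add.commute)
    next
      case 3
      then show False
        using lower_half_sum[OF q(1) 3] xy ndvd[of y] unfolding B_def by blast
    qed
  qed
  have prod: False if xy: "x \<in> B" "y \<in> B" "[x * y = 1] (mod q)" for x y
  proof -
    have d: "q dvd x * y - 1"
      using xy(3) by (simp add: cong_iff_dvd_diff)
    consider "x = 2" | "y = 2" | "lower_half q x" "lower_half q y"
      using xy(1,2) unfolding B_def by blast
    then show False
    proof cases
      case 1
      then show False using d not_zero(3)[OF xy(2)] by simp
    next
      case 2
      then show False using d not_zero(3)[OF xy(1)] by (simp add: mult.commute)
    next
      case 3
      then show False
        using lower_half_prod[OF q(1) 3] xy ndvd[of y] unfolding B_def by blast
    qed
  qed
  \<comment> \<open>The representative of \<open>1 - x\<close> that maps \<open>{2..q - 1}\<close>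
    to itself.\<close>
  let ?s = "\<lambda>x. q + 1 - x"
  have fin: "finite B"
    unfolding B_def by (rule finite_subset[of _ "{2..q - 1}"]) auto
  have disj: "B \<inter> ?s ` B = {}"
  proof (rule ccontr)
    assume "B \<inter> ?s ` B \<noteq> {}"
    then obtain x where x: "x \<in> B" "?s x \<in> B"
      by blast
    have "[x + ?s x = 1] (mod q)"
      by (simp add: cong_iff_dvd_diff)
    then show False
      using sum x by blast
  qed
  \<comment> \<open>The removed point represents 1/2, the only fixed point of
    \<open>?s\<close>.\<close>
  have union: "B \<union> ?s ` B = {2..q - 1} - {(q + 1) div 2}"
  proof (intro equalityI subsetI)
    fix x
    assume "x \<in> B \<union> ?s ` B"
    moreover have "B \<subseteq> {2..q - 1}"
      unfolding B_def by blast
    moreover have "x \<noteq> (q + 1) div 2"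
    proof
      assume "x = (q + 1) div 2"
      then have "?s x = x"
        using odd by auto
      then have "x \<in> B \<inter> ?s ` B"
        using \<open>x \<in> B \<union> ?s ` B\<close> by force
      then show False
        using disj by blast
    qed
    ultimately show "x \<in> {2..q - 1} - {(q + 1) div 2}"
      by auto
  next
    fix x
    assume x: "x \<in> {2..q - 1} - {(q + 1) div 2}"
    have "x \<in> B \<or> ?s x \<in> B"
    \<comment> \<open>The zeros 2 and -1 of \<open>h\<close> are exchanged by \<open>?s\<close>, and
      2 is in \<open>B\<close> by construction.\<close>
    proof (cases "x = 2 \<or> x = q - 1")
      case True
      then show ?thesis
        using q unfolding B_def by auto
    next
      case False
      then have b: "2 < x" "x < q - 1"
        using x by auto
      have "\<not> q dvd 2 * x - 1"
      proof
        assume "q dvd 2 * x - 1"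
        then obtain c where c: "2 * x - 1 = q * c" ..
        \<comment> \<open>The bounds leave only \<open>c = 1\<close>, which makes \<open>x\<close>
          the excluded midpoint.\<close>
        have "0 < q * c" "q * c < q * 2"
          using b by (simp_all flip: c)
        then have "0 < c" "c < 2"
          using q mult_less_cancel_left_pos[of q c 2] by (simp_all add: zero_less_mult_iff)
        then have "c = 1"
          by simp
        then have "q + 1 = 2 * x"
          using c by simp
        then show False
          using x by simp
      qed
      moreover have "\<not> q dvd x + 1" "\<not> q dvd x - 2"
        using b zdvd_imp_le[of q "x + 1"] zdvd_imp_le[of q "x - 2"] by auto
      moreover have "[?s x = 1 - x] (mod q)"
        by (simp add: cong_iff_dvd_diff)
      ultimately have "lower_half q x \<or> lower_half q (?s x)"
        using lower_half_or_reflection[OF q(1), of x "?s x"] ndvd[of x] x odd by simp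
      then show ?thesis
        using b unfolding B_def by auto
    qed
    then show "x \<in> B \<union> ?s ` B"
      by force
  qed
  have "card (?s ` B) = card B"
    by (intro card_image) (simp add: inj_on_def)
  \<comment> \<open>The interval has \<open>q - 2\<close> elements and loses its midpoint, so
    \<open>B\<close> has \<open>(p - 3) / 2\<close>; inserting 0 supplies the missing one.\<close>
  then have "2 * card B = card (B \<union> ?s ` B)"
    using card_Un_disjoint[OF fin _ disj] fin by simp
  also have "\<dots> = card {2..q - 1} - 1"
    unfolding union using q by (subst card_Diff_singleton) auto
  also have "\<dots> = p - 3"
    by (simp add: q_def)
  finally have card_B: "2 * card B = p - 3" .
  have "0 \<notin> B"
    unfolding B_def by simp
  then have "card (insert 0 B) = (p - 1) div 2"
    using card_B fin assms by simp
  moreover have "insert 0 B \<subseteq> carrier (residue_ring q)"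
    using q unfolding B_def residue_ring_def by auto
  moreover have "\<one>\<^bsub>residue_ring q\<^esub> \<notin> insert 0 B <+>\<^bsub>residue_ring q\<^esub> insert 0 B"
  proof
    assume "\<one>\<^bsub>residue_ring q\<^esub> \<in> insert 0 B <+>\<^bsub>residue_ring q\<^esub> insert 0 B"
    then obtain x y where xy: "x \<in> insert 0 B" "y \<in> insert 0 B" "(x + y) mod q = 1"
      by (force simp: set_add_def' residue_ring_def)
    \<comment> \<open>A summand 0 would force the other to be 1 modulo \<open>q\<close>, but neither
      0 nor any element of \<open>{2..q - 1}\<close> is.\<close>
    then have "x \<in> B" "y \<in> B"
      unfolding B_def by auto
    then show False
      using sum xy q by (auto simp: cong_def)
  qed
  moreover have "\<one>\<^bsub>residue_ring q\<^esub> \<notin> insert 0 B <#>\<^bsub>residue_ring q\<^esub> insert 0 B"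
  proof
    assume "\<one>\<^bsub>residue_ring q\<^esub> \<in> insert 0 B <#>\<^bsub>residue_ring q\<^esub> insert 0 B"
    then obtain x y where xy: "x \<in> insert 0 B" "y \<in> insert 0 B" "1 = (x * y) mod q"
      unfolding set_mult_def residue_ring_def by fastforce
    then have "x \<in> B" "y \<in> B"
      by auto
    moreover have "[x * y = 1] (mod q)"
      using xy(3)[symmetric] q by (simp add: cong_def)
    ultimately show False
      by (rule prod)
  qed
  ultimately show ?thesis
    unfolding q_def by blast
qed

end
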